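(* Let $\kappa>0$, $a>0$, $r>0$, $t>0$, and let $v$ be a number that is not an integer (in particular $v\neq0$). The solution $u(r,t)$ of the axisymmetric diffusion equation with initial data $u(r,0)=I_v(ar)K_v(ar)$ is given by $$u(r,t)=e^{-r^2/(4\kappa t)}\frac{(4\kappa t a^2)^{v}}{4\sqrt{\pi}}\sum_{n\ge0}{}_1F_1\left(1+v+n;1;\frac{r^2}{4\kappa t}\right)\frac{\Gamma(1+v+n)\Gamma(-v-n)\Gamma(\frac{1}{2}+n+v)}{n!\,\Gamma(2v+1+n)}(-4a^2\kappa t)^n$$ $$+\frac{e^{-r^2/(4\kappa t)}}{4\sqrt{\pi}}\sum_{n\ge0}{}_1F_1\left(1+n;1;\frac{r^2}{4\kappa t}\right)\frac{\Gamma(v-n)\Gamma(\frac{1}{2}+n)}{\Gamma(v+1+n)}(-4a^2\kappa t)^n.$$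
   Context: The axisymmetric diffusion equation with diffusivity constant $\kappa>0$ is $\kappa\left(u_{rr}+\frac{1}{r}u_r\right)=u_t$ for $r\in(0,\infty)$, $t>0$, with initial condition $u(r,0)=g(r)$. Its solution means the explicit solution $$u(r,t)=\frac{1}{2\kappa t}e^{-r^2/(4\kappa t)}\int_{0}^{\infty}y\,g(y)\,I_0\left(\frac{yr}{2\kappa t}\right)e^{-y^2/(4\kappa t)}\,dy.$$ $I_v(x)=\sum_{n\ge0}\frac{1}{n!\,\Gamma(v+n+1)}\left(\frac{x}{2}\right)^{2n+v}$ is the modified Bessel function of the first kind, and $K_v(x)=\frac{\pi(I_{-v}(x)-I_v(x))}{2\sin(\pi v)}$ (for $v\notin\mathbb{Z}$) is the modified Bessel function of the second kind. ${}_1F_1(a;b;x)=\sum_{k\ge 0}\frac{(a)_k}{(b)_k}\frac{x^k}{k!}$ is the confluent hypergeometric function, with $(a)_k=a(a+1)\cdots(a+k-1)$ and $(a)_0=1$ (here $a$, $b$ denote generic parameters).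
   Formalization: The prefactor 1/(4√π) of both series is corrected to 1/(2√π) (the printed formula gives half of u); v may be complex, with Re v > -1 (otherwise the integral defining u diverges) and v ≠ -1/2 (where the n=0 term contains Γ(0)/Γ(0)). *)

theory Defs
  imports "HOL-Analysis.Analysis"
begin

text \<open>
  Powers are principal-branch. At poles \<^term>\<open>Gamma\<close> is 0 and hence its quotient \<open>1 / Gamma\<close> is 0
  as well, which is the usual convention for terms with \<open>v + n + 1\<close> a nonpositive integer.
  Since \<open>0 powr 0 = 0\<close>, the value at \<open>z = 0\<close> is not meaningful for \<open>v = 0\<close>; only arguments
  \<open>z > 0\<close> are used below.
\<close>

definition bessel_I :: "complex \<Rightarrow> complex \<Rightarrow> complex" where
  "bessel_I v z = (\<Sum>n. 1 / (fact n * Gamma (v + of_nat n + 1)) * (z / 2) powr (2 * of_nat n + v))"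

text \<open>Meaningful for non-integer \<open>v\<close> only.\<close>

definition bessel_K :: "complex \<Rightarrow> complex \<Rightarrow> complex" where
  "bessel_K v z = of_real pi * (bessel_I (- v) z - bessel_I v z) / (2 * sin (of_real pi * v))"

definition hypergeom_1F1 :: "complex \<Rightarrow> complex \<Rightarrow> complex \<Rightarrow> complex" where
  "hypergeom_1F1 a b z = (\<Sum>k. pochhammer a k / pochhammer b k * (z ^ k / fact k))"

text \<open>
  The explicit solution of \<open>\<kappa> (u\<^sub>r\<^sub>r + u\<^sub>r / r) = u\<^sub>t\<close> with initial data \<open>g\<close>. The Lebesgue integral
  is 0 by convention when the integrand is not integrable, so a statement about
  \<open>axisym_diffusion_solution\<close> is only meaningful together with integrability of
  \<open>axisym_diffusion_integrand\<close>.
\<close>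

definition axisym_diffusion_integrand ::
    "real \<Rightarrow> (real \<Rightarrow> complex) \<Rightarrow> real \<Rightarrow> real \<Rightarrow> real \<Rightarrow> complex" where
  "axisym_diffusion_integrand \<kappa> g r t y =
     of_real y * g y * bessel_I 0 (of_real (y * r / (2 * \<kappa> * t))) *
     of_real (exp (- y\<^sup>2 / (4 * \<kappa> * t)))"

definition axisym_diffusion_solution ::
    "real \<Rightarrow> (real \<Rightarrow> complex) \<Rightarrow> real \<Rightarrow> real \<Rightarrow> complex" where
  "axisym_diffusion_solution \<kappa> g r t =
     of_real (1 / (2 * \<kappa> * t) * exp (- r\<^sup>2 / (4 * \<kappa> * t))) *
     (LINT y:{0<..}|lborel. axisym_diffusion_integrand \<kappa> g r t y)"

definition IK_initial :: "complex \<Rightarrow> real \<Rightarrow> real \<Rightarrow> complex" where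
  "IK_initial v a y = bessel_I v (of_real (a * y)) * bessel_K v (of_real (a * y))"

text \<open>
  The two series in the solution for the initial data \<open>IK_initial v a\<close>. Their common prefactor in
  that solution is \<open>1 / (2 sqrt pi)\<close>; the value \<open>1 / (4 sqrt pi)\<close> found in print is too small by a
  factor 2. For instance, if \<open>v > 0\<close> and \<open>a\<close> tends to 0, then the initial data tend to the constant
  \<open>1 / (2 v)\<close>, hence so does the solution, while the second series tends to
  \<open>exp (r\<^sup>2 / (4 \<kappa> t)) sqrt pi / v\<close> and the contribution of the first one vanishes.
\<close>

definition IK_term1 :: "complex \<Rightarrow> real \<Rightarrow> real \<Rightarrow> real \<Rightarrow> real \<Rightarrow> nat \<Rightarrow> complex" where
  "IK_term1 v \<kappa> a r t n =
     hypergeom_1F1 (1 + v + of_nat n) 1 (of_real (r\<^sup>2 / (4 * \<kappa> * t))) *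
     (Gamma (1 + v + of_nat n) * Gamma (- v - of_nat n) * Gamma (1 / 2 + of_nat n + v) /
       (fact n * Gamma (2 * v + 1 + of_nat n))) *
     of_real (- 4 * a\<^sup>2 * \<kappa> * t) ^ n"

definition IK_term2 :: "complex \<Rightarrow> real \<Rightarrow> real \<Rightarrow> real \<Rightarrow> real \<Rightarrow> nat \<Rightarrow> complex" where
  "IK_term2 v \<kappa> a r t n =
     hypergeom_1F1 (1 + of_nat n) 1 (of_real (r\<^sup>2 / (4 * \<kappa> * t))) *
     (Gamma (v - of_nat n) * Gamma (1 / 2 + of_nat n) / Gamma (v + 1 + of_nat n)) *
     of_real (- 4 * a\<^sup>2 * \<kappa> * t) ^ n"

end

theory Submission
  imports Defs
begin

text \<open>
  Put \<open>p = 1 / (4 \<kappa> t)\<close>. Since \<open>K\<^sub>v\<close> is a combination of \<open>I\<^sub>-\<^sub>v\<close> and \<open>I\<^sub>v\<close>, the initial data are a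
  combination of \<open>I\<^sub>v I\<^sub>-\<^sub>v\<close> and \<open>I\<^sub>v\<^sup>2\<close>. By Vandermonde's identity, a product \<open>I\<^sub>\<mu> I\<^sub>\<nu>\<close> is again a power
  of the argument times an explicit even power series. The partial sums of this series, and those of
  \<open>I\<^sub>0\<close>, are of at most exponential growth, so dominated convergence against the weight
  \<open>exp (- p y\<^sup>2)\<close> allows termwise integration. For a single power of \<open>y\<close>, expanding \<open>I\<^sub>0\<close> gives Gamma
  integrals that sum to a \<open>1F1\<close>. The duplication and reflection formulas for \<open>Gamma\<close> turn the
  resulting coefficients into the stated ones.
\<close>

section \<open>Bessel series and their products\<close>

text \<open>The recurrence of \<open>rGamma\<close> divides by \<open>v + n + 1\<close>, whose norm
  is at least \<open>(n + 1) / 2\<close> once \<open>n \<ge> 2 * norm v\<close>. From there on the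
  scaled sequence \<open>q\<close> is nonincreasing, so its maximum over the initial indices bounds
  it everywhere. The factor \<open>2 ^ n\<close> pays for this crude estimate.\<close>

lemma rGamma_shift_bound:
  fixes v :: complex
  obtains B where "\<And>n. norm (rGamma (v + of_nat n + 1)) \<le> B * 2 ^ n / fact n"
proof -
  define q where "q n = norm (rGamma (v + of_nat n + 1)) * fact n / 2 ^ n" for n
  obtain N :: nat where N: "2 * norm v \<le> N"
    using real_arch_simple by blast
  have dec: "q (Suc n) \<le> q n" if "n \<ge> N" for n
  proof -
    have "real n + 1 \<le> 2 * norm (v + of_nat n + 1)"
    proof -
      have "norm (of_nat (Suc n) :: complex) \<le> norm (v + of_nat n + 1) + norm v"
        using norm_triangle_ineq4[of "v + of_nat n + 1" v] by (simp add: algebra_simps)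
      then show ?thesis using N that by (simp add: norm_of_nat del: of_nat_Suc)
    qed
    moreover have "norm (rGamma (v + of_nat n + 1)) =
        norm (v + of_nat n + 1) * norm (rGamma (v + of_nat (Suc n) + 1))"
      using rGamma_plus1[of "v + of_nat n + 1"] by (simp add: norm_mult[symmetric] algebra_simps)
    ultimately have *: "(real n + 1) * norm (rGamma (v + of_nat (Suc n) + 1)) \<le>
        2 * norm (rGamma (v + of_nat n + 1))"
      by (simp add: mult_right_mono mult.assoc[symmetric])
    show ?thesis
      using mult_right_mono[OF *, of "fact n / 2 ^ Suc n"]
      unfolding q_def fact_Suc power_Suc by (simp add: mult_ac add_ac)
  qed
  have "q n \<le> Max (q ` {..N})" for n
  proof (induction n)
    case (Suc n)
    then show ?case using dec[of n] by (cases "n \<ge> N") (auto simp: not_le Suc_le_eq)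
  qed simp
  then have "norm (rGamma (v + of_nat n + 1)) \<le> Max (q ` {..N}) * 2 ^ n / fact n" for n
    unfolding q_def by (simp add: divide_simps)
  then show ?thesis by (rule that)
qed

text \<open>A sum of squares of nonnegative numbers is at most the square of their sum, and that sum
  is at most \<open>exp x\<close>. Bessel coefficients decay like \<open>1 / (fact n)^2\<close> up
  to geometric factors, so this keeps their series of exponential growth.\<close>

lemma exp_square_partial_sum_le:
  fixes x :: real
  assumes "x \<ge> 0"
  shows "(\<Sum>n<N. (x ^ n / fact n)\<^sup>2) \<le> exp (2 * x)"
proof -
  have *: "(\<Sum>n<N. (f n)\<^sup>2) \<le> (\<Sum>n<N. f n)\<^sup>2" if "\<And>n. f n \<ge> 0" for f :: "nat \<Rightarrow> real" and N
    by (induction N) (simp_all add: power2_sum that sum_nonneg add_increasing2)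
  have "(\<Sum>n<N. (x ^ n / fact n)\<^sup>2) \<le> (\<Sum>n<N. x ^ n / fact n)\<^sup>2"
    using assms by (intro *) auto
  also have "(\<Sum>n<N. x ^ n / fact n) \<le> exp x"
  proof -
    have s: "(\<lambda>n. x ^ n / fact n) sums exp x"
      using exp_converges[of x] by (simp add: divide_inverse mult.commute)
    then have "(\<Sum>n<N. x ^ n / fact n) \<le> (\<Sum>n. x ^ n / fact n)"
      using assms by (intro sum_le_suminf) (auto simp: sums_iff)
    then show ?thesis using s by (simp add: sums_iff)
  qed
  then have "(\<Sum>n<N. x ^ n / fact n)\<^sup>2 \<le> (exp x)\<^sup>2"
    using assms by (intro power_mono sum_nonneg) auto
  finally show ?thesis by (simp add: exp_double)
qed

text \<open>These are the coefficients of I_v in even powers of the half argument, with the leading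
  power removed. Since \<open>rGamma\<close> is entire, its recurrence holds for every order without
  a case distinction at poles.\<close>

definition bessel_coeff :: "complex \<Rightarrow> nat \<Rightarrow> complex" where
  "bessel_coeff v n = rGamma (v + of_nat n + 1) / fact n"

text \<open>The constant \<open>B\<close> depends on \<open>v\<close> alone. Uniformity in
  \<open>N\<close> and \<open>z\<close> is what later yields a dominating function.\<close>

lemma bessel_coeff_partial_sum_bound:
  obtains B where
    "\<And>N z. (\<Sum>n<N. norm (bessel_coeff v n * z ^ (2 * n))) \<le> B * exp (4 * norm z)"
proof -
  obtain B where B: "\<And>n. norm (rGamma (v + of_nat n + 1)) \<le> B * 2 ^ n / fact n"
    using rGamma_shift_bound by blast
  have "0 \<le> B" using order.trans[OF norm_ge_zero B[of 0]] by simp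
  have partial: "(\<Sum>n<N. norm (bessel_coeff v n * z ^ (2 * n))) \<le> B * exp (4 * norm z)" for N z
  proof -
    have "(\<Sum>n<N. norm (bessel_coeff v n * z ^ (2 * n)))
        \<le> (\<Sum>n<N. B * ((2 * norm z) ^ n / fact n)\<^sup>2)"
    proof (rule sum_mono)
      fix n
      have "norm (bessel_coeff v n * z ^ (2 * n)) \<le> (B * 2 ^ n / fact n) / fact n * norm z ^ (2 * n)"
        unfolding bessel_coeff_def norm_mult norm_divide norm_power
        using divide_right_mono[OF B[of n], of "fact n"] by (intro mult_right_mono) (simp_all add: norm_fact)
      also have "\<dots> = B * ((norm z ^ n / fact n)\<^sup>2 * 2 ^ n)"
        by (simp add: power2_eq_square power_mult field_simps)
      \<comment> \<open>Enlarging \<open>2 ^ n\<close> to \<open>4 ^ n\<close> makes each term a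
        perfect square, as needed for the bound on sums of squares.\<close>
      also have "\<dots> \<le> B * ((norm z ^ n / fact n)\<^sup>2 * 4 ^ n)"
        using \<open>0 \<le> B\<close> by (intro mult_left_mono power_mono) auto
      also have "\<dots> = B * ((2 * norm z) ^ n / fact n)\<^sup>2"
      proof -
        have "(4::real) ^ n = (2 ^ n)\<^sup>2" by (simp add: power2_eq_square flip: power_mult_distrib)
        then show ?thesis by (simp add: power_mult_distrib power_divide)
      qed
      finally show "norm (bessel_coeff v n * z ^ (2 * n)) \<le> B * ((2 * norm z) ^ n / fact n)\<^sup>2" .
    qed
    also have "\<dots> \<le> B * exp (2 * (2 * norm z))"
      unfolding sum_distrib_left[symmetric]
      using \<open>0 \<le> B\<close> by (intro mult_left_mono exp_square_partial_sum_le) auto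
    finally show ?thesis by simp
  qed
  then show ?thesis by (rule that)
qed

lemma summable_bessel_coeff: "summable (\<lambda>n. norm (bessel_coeff v n * z ^ (2 * n)))"
proof -
  obtain B where "\<And>N z. (\<Sum>n<N. norm (bessel_coeff v n * z ^ (2 * n))) \<le> B * exp (4 * norm z)"
    using bessel_coeff_partial_sum_bound[of v] by blast
  then show ?thesis
    by (intro bounded_imp_summable[of _ "B * exp (4 * norm z)"])
       (simp_all only: lessThan_Suc_atMost[symmetric] norm_ge_zero)
qed

lemma bessel_coeff_suminf_bound:
  obtains B where "\<And>z. (\<Sum>n. norm (bessel_coeff v n * z ^ (2 * n))) \<le> B * exp (4 * norm z)"
proof -
  obtain B where "\<And>N z. (\<Sum>n<N. norm (bessel_coeff v n * z ^ (2 * n))) \<le> B * exp (4 * norm z)"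
    using bessel_coeff_partial_sum_bound[of v] by blast
  then have "(\<Sum>n. norm (bessel_coeff v n * z ^ (2 * n))) \<le> B * exp (4 * norm z)" for z
    by (rule suminf_le_const[OF summable_bessel_coeff])
  then show ?thesis by (rule that)
qed

text \<open>For \<open>x > 0\<close> the base is nonzero, so each complex power splits into the
  common factor \<open>(x / 2) powr v\<close> and a natural power of the half argument.\<close>

lemma bessel_I_conv_coeff:
  fixes x :: real
  assumes "x > 0"
  shows "bessel_I v (of_real x) =
    of_real (x / 2) powr v * (\<Sum>n. bessel_coeff v n * of_real (x / 2) ^ (2 * n))"
proof -
  define z :: complex where "z = of_real (x / 2)"
  have "1 / (fact n * Gamma (v + of_nat n + 1)) * z powr (2 * of_nat n + v) =
      z powr v * (bessel_coeff v n * z ^ (2 * n))" for n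
  proof -
    have "z powr (2 * of_nat n + v) = z ^ (2 * n) * z powr v"
      using assms powr_nat'[of z "2 * n"] by (simp add: powr_add z_def)
    then show ?thesis
      by (simp add: bessel_coeff_def rGamma_inverse_Gamma divide_inverse mult_ac)
  qed
  moreover have "of_real x / 2 = z" by (simp add: z_def)
  ultimately show ?thesis
    unfolding bessel_I_def z_def[symmetric]
    using suminf_mult[OF summable_norm_cancel[OF summable_bessel_coeff]] by simp
qed

text \<open>Coefficients of the classical series for I_\<mu> I_\<nu>. The generalised binomial is a
  polynomial in \<open>\<mu> + \<nu>\<close>, so it keeps its meaning where the Gamma quotient it
  stands for meets poles.\<close>

definition bessel_prod_coeff :: "complex \<Rightarrow> complex \<Rightarrow> nat \<Rightarrow> complex" where
  "bessel_prod_coeff \<mu> \<nu> n =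
     ((\<mu> + \<nu> + 2 * of_nat n) gchoose n) / (Gamma (\<mu> + of_nat n + 1) * Gamma (\<nu> + of_nat n + 1))"

text \<open>This is Vandermonde's identity with every binomial written as a Gamma quotient.
  Non-integral orders keep the numerators away from the poles, so these can be divided out.\<close>

lemma Cauchy_product_bessel_coeff:
  assumes "\<mu> \<notin> \<int>" and "\<nu> \<notin> \<int>"
  shows "(\<Sum>k\<le>n. bessel_coeff \<mu> k * bessel_coeff \<nu> (n - k)) = bessel_prod_coeff \<mu> \<nu> n"
proof -
  have nonpole: "\<mu> + of_nat m + 1 \<notin> \<int>\<^sub>\<le>\<^sub>0" "\<nu> + of_nat m + 1 \<notin> \<int>\<^sub>\<le>\<^sub>0" for m
    using assms by (auto dest!: nonpos_Ints_Int)
  \<comment> \<open>The orders are crossed on purpose: choosing \<open>k\<close> from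
    \<open>\<nu> + n\<close> produces \<open>fact k\<close> together with the Gamma value of index
    \<open>n - k\<close>, and the other binomial supplies the complementary pair.\<close>
  have "(\<mu> + \<nu> + 2 * of_nat n) gchoose n = ((\<nu> + of_nat n) + (\<mu> + of_nat n)) gchoose n"
    by (simp add: algebra_simps)
  also have "\<dots> = (\<Sum>k\<le>n. ((\<nu> + of_nat n) gchoose k) * ((\<mu> + of_nat n) gchoose (n - k)))"
    by (simp only: gbinomial_Vandermonde atMost_atLeast0)
  also have "\<dots> = (\<Sum>k\<le>n. Gamma (\<mu> + of_nat n + 1) * Gamma (\<nu> + of_nat n + 1) *
      (bessel_coeff \<mu> k * bessel_coeff \<nu> (n - k)))"
  proof (rule sum.cong)
    fix k assume "k \<in> {..n}"
    then have shift: "\<mu> + of_nat n - of_nat (n - k) + 1 = \<mu> + of_nat k + 1"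
      "\<nu> + of_nat n - of_nat k + 1 = \<nu> + of_nat (n - k) + 1"
      by (simp_all add: of_nat_diff)
    then show "((\<nu> + of_nat n) gchoose k) * ((\<mu> + of_nat n) gchoose (n - k)) =
        Gamma (\<mu> + of_nat n + 1) * Gamma (\<nu> + of_nat n + 1) *
        (bessel_coeff \<mu> k * bessel_coeff \<nu> (n - k))"
      unfolding gbinomial_Gamma[OF nonpole(1)] gbinomial_Gamma[OF nonpole(2)] shift
        bessel_coeff_def rGamma_inverse_Gamma
      by (simp add: divide_inverse mult_ac)
  qed simp
  finally show ?thesis
    using nonpole[of n] by (simp add: bessel_prod_coeff_def sum_distrib_left[symmetric] Gamma_eq_zero_iff)
qed

lemma Cauchy_product_bessel_coeff_powers:
  assumes "\<mu> \<notin> \<int>" and "\<nu> \<notin> \<int>"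
  shows "(\<Sum>k\<le>n. (bessel_coeff \<mu> k * z ^ (2 * k)) * (bessel_coeff \<nu> (n - k) * z ^ (2 * (n - k)))) =
    bessel_prod_coeff \<mu> \<nu> n * z ^ (2 * n)"
proof -
  have "z ^ (2 * n) = z ^ (2 * k) * z ^ (2 * (n - k))" if "k \<le> n" for k
    by (metis add_mult_distrib2 le_add_diff_inverse power_add that)
  then show ?thesis
    unfolding Cauchy_product_bessel_coeff[OF assms, symmetric] sum_distrib_right
    by (intro sum.cong) (simp_all add: mult_ac)
qed

text \<open>Removing the leading powers leaves a Cauchy product of two absolutely convergent even
  power series.\<close>

lemma bessel_prod_coeff_sums:
  assumes "\<mu> \<notin> \<int>" and "\<nu> \<notin> \<int>" and "x > 0"
  shows "(\<lambda>n. bessel_prod_coeff \<mu> \<nu> n * of_real (x / 2) ^ (2 * n)) sums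
    (of_real (x / 2) powr (- (\<mu> + \<nu>)) * (bessel_I \<mu> (of_real x) * bessel_I \<nu> (of_real x)))"
proof -
  let ?z = "of_real (x / 2) :: complex"
  have "?z powr (- (\<mu> + \<nu>)) * (?z powr \<mu> * ?z powr \<nu>) = 1"
    using assms by (simp add: powr_add[symmetric] powr_minus)
  then have "of_real (x / 2) powr (- (\<mu> + \<nu>)) * (bessel_I \<mu> (of_real x) * bessel_I \<nu> (of_real x)) =
    (\<Sum>n. bessel_coeff \<mu> n * ?z ^ (2 * n)) * (\<Sum>n. bessel_coeff \<nu> n * ?z ^ (2 * n))"
    using assms by (simp add: bessel_I_conv_coeff mult_ac)
  then show ?thesis
    using Cauchy_product_sums[OF summable_bessel_coeff[of \<mu> ?z] summable_bessel_coeff[of \<nu> ?z]] unfolding Cauchy_product_bessel_coeff_powers[OF assms(1,2)] by simp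
qed

text \<open>By the triangle inequality the partial sums are dominated by the Cauchy product of the
  two series of norms, hence by the product of their sums. Two factors
  \<open>exp (4 * norm z)\<close> give the rate 8.\<close>

lemma bessel_prod_coeff_bound:
  assumes "\<mu> \<notin> \<int>" and "\<nu> \<notin> \<int>"
  obtains C where "\<And>N z. norm (\<Sum>n<N. bessel_prod_coeff \<mu> \<nu> n * z ^ (2 * n)) \<le> C * exp (8 * norm z)"
proof -
  obtain C where C: "\<And>z. (\<Sum>n. norm (bessel_coeff \<mu> n * z ^ (2 * n))) \<le> C * exp (4 * norm z)"
    using bessel_coeff_suminf_bound[of \<mu>] by blast
  obtain C' where C': "\<And>z. (\<Sum>n. norm (bessel_coeff \<nu> n * z ^ (2 * n))) \<le> C' * exp (4 * norm z)"
    using bessel_coeff_suminf_bound[of \<nu>] by blast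
  have "norm (\<Sum>n<N. bessel_prod_coeff \<mu> \<nu> n * z ^ (2 * n)) \<le> (C * C') * exp (8 * norm z)" for N z
  proof -
    let ?a = "\<lambda>n. norm (bessel_coeff \<mu> n * z ^ (2 * n))"
    let ?b = "\<lambda>n. norm (bessel_coeff \<nu> n * z ^ (2 * n))"
    have prod: "(\<lambda>n. \<Sum>k\<le>n. ?a k * ?b (n - k)) sums ((\<Sum>n. ?a n) * (\<Sum>n. ?b n))"
      by (intro Cauchy_product_sums) (simp_all add: summable_bessel_coeff)
    have "norm (\<Sum>n<N. bessel_prod_coeff \<mu> \<nu> n * z ^ (2 * n)) \<le> (\<Sum>n<N. \<Sum>k\<le>n. ?a k * ?b (n - k))"
      unfolding Cauchy_product_bessel_coeff_powers[OF assms, symmetric]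
      by (intro sum_norm_le order.trans[OF norm_sum]) (auto simp: norm_mult intro!: sum_mono)
    also have "\<dots> \<le> (\<Sum>n. ?a n) * (\<Sum>n. ?b n)"
      using prod sum_le_suminf[of "\<lambda>n. \<Sum>k\<le>n. ?a k * ?b (n - k)" "{..<N}"]
      by (auto simp: sums_iff sum_nonneg)
    also have "\<dots> \<le> (C * exp (4 * norm z)) * (C' * exp (4 * norm z))"
      by (intro mult_mono C C' order.trans[OF suminf_nonneg C] suminf_nonneg summable_bessel_coeff) auto
    also have "\<dots> = C * C' * exp (8 * norm z)"
      by (simp add: exp_add[symmetric])
    finally show ?thesis .
  qed
  then show ?thesis by (rule that)
qed

section \<open>Gaussian integrals of power series\<close>

text \<open>Substitute \<open>t = p * y^2\<close> in Euler's integral for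
  \<open>Gamma (s + 1)\<close>; the derivative \<open>2 * p * y\<close> raises the exponent
  \<open>2 * s\<close> to \<open>2 * s + 1\<close>.\<close>

lemma
  fixes s :: complex and p :: real
  assumes s: "Re s > - 1" and p: "p > 0"
  shows set_integrable_gaussian_moment:
      "set_integrable lborel {0<..} (\<lambda>y. of_real y powr (2 * s + 1) * of_real (exp (- p * y\<^sup>2)) :: complex)"
      (is "set_integrable _ _ ?m")
    and gaussian_moment:
      "(LINT y:{0<..}|lborel. of_real y powr (2 * s + 1) * of_real (exp (- p * y\<^sup>2))) =
        Gamma (s + 1) / (2 * of_real p powr (s + 1))"
proof -
  let ?f = "\<lambda>t::real. (of_real t :: complex) powr s / of_real (exp t)"
  let ?g = "\<lambda>y::real. p * y\<^sup>2"
  have img: "?g ` {0<..} = {0<..}"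
  proof (intro equalityI subsetI)
    fix t :: real assume "t \<in> {0<..}"
    then have "t = ?g (sqrt (t / p))" "sqrt (t / p) \<in> {0<..}" using p by auto
    then show "t \<in> ?g ` {0<..}" by blast
  qed (use p in auto)
  have "?f absolutely_integrable_on {0<..}"
    using absolutely_integrable_Gamma_integral[of "s + 1" 1] s by simp
  moreover have "integral {0<..} ?f = Gamma (s + 1)"
  proof -
    have "(?f has_integral Gamma (s + 1)) {0..}"
      using Gamma_integral_complex[of "s + 1"] s by simp
    \<comment> \<open>Dropping the endpoint 0 changes the domain by a null set only.\<close>
    then have "(?f has_integral Gamma (s + 1)) {0<..}"
      by (subst (asm) has_integral_spike_set_eq[where T = "{0<..}"])
         (auto intro!: negligible_subset[OF negligible_sing[of 0]])
    then show ?thesis by (rule integral_unique)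
  qed
  ultimately have sub: "(\<lambda>y. \<bar>2 * p * y\<bar> *\<^sub>R ?f (?g y)) absolutely_integrable_on {0<..} \<and>
      integral {0<..} (\<lambda>y. \<bar>2 * p * y\<bar> *\<^sub>R ?f (?g y)) = Gamma (s + 1)"
    using p by (subst has_absolute_integral_change_of_variables_real[where b = "Gamma (s + 1)"])
      (auto simp: img inj_on_def power2_eq_iff intro!: derivative_eq_intros)
  have eq: "\<bar>2 * p * y\<bar> *\<^sub>R ?f (?g y) = (2 * of_real p powr (s + 1)) * ?m y" if "y > 0" for y :: real
  proof -
    have "(of_real (p * y\<^sup>2) :: complex) powr s = of_real p powr s * of_real y powr (2 * s)"
      using that p by (simp add: powr_times_real powr_power power2_eq_square powr_add[symmetric])
    then show ?thesis
      using that p by (simp add: powr_add exp_minus divide_inverse scaleR_conv_of_real)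
  qed
  have c: "2 * complex_of_real p powr (s + 1) \<noteq> 0" using p by simp
  have abs_int: "(\<lambda>y. (2 * of_real p powr (s + 1)) * ?m y) absolutely_integrable_on {0<..}"
    using sub by (subst set_integrable_cong[OF refl refl eq[symmetric]]) auto
  then have "set_integrable lebesgue {0<..} ?m"
    using c by (simp add: set_integrable_mult_right_iff)
  \<comment> \<open>The change of variables lives in the completed measure. Borel measurability,
    from continuity on the open half-line, carries integrability back to
    \<open>lborel\<close>.\<close>
  then show int: "set_integrable lborel {0<..} ?m"
    unfolding set_integrable_def
    by (subst (asm) integrable_completion)
       (auto intro!: borel_measurable_continuous_on_indicator continuous_intros)
  have "Gamma (s + 1) = integral {0<..} (\<lambda>y. (2 * of_real p powr (s + 1)) * ?m y)"
    using sub eq by (subst (asm) integral_cong[OF eq]) auto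
  also have "\<dots> = (2 * of_real p powr (s + 1)) * (LINT y:{0<..}|lborel. ?m y)"
    using set_borel_integral_eq_integral(2)[OF int] by simp
  finally show "(LINT y:{0<..}|lborel. ?m y) = Gamma (s + 1) / (2 * of_real p powr (s + 1))"
    using c by (simp add: field_simps)
qed

text \<open>Half of the Gaussian absorbs the exponential: expanding
  \<open>(D - p * y)^2 \<ge> 0\<close> bounds \<open>D * y\<close> by
  \<open>D^2 / (2 * p) + p / 2 * y^2\<close>. What remains is a Gaussian moment with parameter
  \<open>p / 2\<close>.\<close>

lemma set_integrable_gaussian_weight:
  fixes s :: complex and p :: real and W :: "real \<Rightarrow> complex"
  assumes s: "Re s > - 1" and p: "p > 0"
    and W: "set_borel_measurable lborel {0<..} W" "\<And>y. y > 0 \<Longrightarrow> norm (W y) \<le> C * exp (D * y)"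
  shows "set_integrable lborel {0<..} (\<lambda>y. of_real y powr (2 * s + 1) * W y * of_real (exp (- p * y\<^sup>2)))"
proof -
  let ?w = "\<lambda>y::real. of_real (C * exp (D\<^sup>2 / (2 * p))) *
    (of_real y powr (2 * s + 1) * of_real (exp (- (p / 2) * y\<^sup>2))) :: complex"
  have int: "set_integrable lborel {0<..} ?w"
    using set_integrable_gaussian_moment[of s "p / 2"] s p by (intro set_integrable_mult_right) auto
  have meas: "set_borel_measurable lborel {0<..}
      (\<lambda>y. of_real y powr (2 * s + 1) * W y * of_real (exp (- p * y\<^sup>2)))"
  proof -
    have "(\<lambda>y. (indicator {0<..} y *\<^sub>R (of_real y powr (2 * s + 1) * of_real (exp (- p * y\<^sup>2)))) *
        (indicator {0<..} y *\<^sub>R W y)) \<in> borel_measurable lborel"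
      using W(1) unfolding set_borel_measurable_def
      by (intro borel_measurable_times)
         (auto intro!: borel_measurable_continuous_on_indicator continuous_intros)
    then show ?thesis
      unfolding set_borel_measurable_def
      by (rule back_subst[where P = "\<lambda>f. f \<in> borel_measurable lborel"])
         (auto simp: fun_eq_iff indicator_def)
  qed
  have bound: "norm (of_real y powr (2 * s + 1) * W y * of_real (exp (- p * y\<^sup>2))) \<le> norm (?w y)"
    if "y > 0" for y
  proof -
    have "D * y \<le> D\<^sup>2 / (2 * p) + p / 2 * y\<^sup>2"
      using zero_le_square[of "D - p * y"] p by (simp add: field_simps power2_eq_square)
    then have e: "exp (D * y) * exp (- p * y\<^sup>2) \<le> exp (D\<^sup>2 / (2 * p)) * exp (- (p / 2) * y\<^sup>2)"
      unfolding exp_add[symmetric] by (subst exp_le_cancel_iff) (simp add: field_simps)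
    \<comment> \<open>The sign of \<open>C\<close> is read off from the bound at this
      \<open>y\<close>, whose left-hand side is a norm.\<close>
    have "0 \<le> C * exp (D * y)" using W(2)[OF that] norm_ge_zero[of "W y"] by linarith
    then have C: "0 \<le> C" by (simp add: zero_le_mult_iff)
    have "norm (W y) * exp (- p * y\<^sup>2) \<le> C * (exp (D * y) * exp (- p * y\<^sup>2))"
      using W(2)[OF that] by (simp add: mult_right_mono mult.assoc[symmetric])
    also have "\<dots> \<le> C * (exp (D\<^sup>2 / (2 * p)) * exp (- (p / 2) * y\<^sup>2))"
      using e C by (intro mult_left_mono)
    finally have "norm (W y) * exp (- p * y\<^sup>2) \<le> C * exp (D\<^sup>2 / (2 * p)) * exp (- (p / 2) * y\<^sup>2)"
      by (simp add: mult.assoc)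
    then have "norm (of_real y powr (2 * s + 1) :: complex) * (norm (W y) * exp (- p * y\<^sup>2)) \<le>
        norm (of_real y powr (2 * s + 1) :: complex) *
          (C * exp (D\<^sup>2 / (2 * p)) * exp (- (p / 2) * y\<^sup>2))"
      by (intro mult_left_mono) auto
    then show ?thesis
      using C by (simp add: norm_mult mult_ac)
  qed
  show ?thesis
    using bound by (intro set_integrable_bound[OF int meas] AE_I2) simp
qed

section \<open>Limits of power series with exponentially bounded partial sums, and termwise
  integration\<close>

lemma
  fixes c :: "nat \<Rightarrow> complex" and F :: "real \<Rightarrow> complex"
  assumes F: "\<And>y. y > 0 \<Longrightarrow> (\<lambda>n. c n * of_real y ^ (2 * n)) sums F y"
  shows set_borel_measurable_power_series: "set_borel_measurable lborel {0<..} F"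
    and power_series_norm_bound:
      "(\<And>N y. y > 0 \<Longrightarrow> norm (\<Sum>n<N. c n * of_real y ^ (2 * n)) \<le> B * exp (E * y)) \<Longrightarrow>
        y > 0 \<Longrightarrow> norm (F y) \<le> B * exp (E * y)"
proof -
  define P where "P N y = (\<Sum>n<N. c n * of_real y ^ (2 * n))" for N and y :: real
  have lim: "(\<lambda>N. P N y) \<longlonglongrightarrow> F y" if "y > 0" for y
    using F[OF that] unfolding P_def sums_def .
  show "set_borel_measurable lborel {0<..} F"
    unfolding set_borel_measurable_def
  proof (rule borel_measurable_LIMSEQ_metric)
    show "(\<lambda>y. indicator {0<..} y *\<^sub>R P N y) \<in> borel_measurable lborel" for N
      unfolding P_def by (auto intro!: borel_measurable_continuous_on_indicator continuous_intros)
    show "(\<lambda>N. indicator {0<..} y *\<^sub>R P N y) \<longlonglongrightarrow> indicator {0<..} y *\<^sub>R F y" for y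
      using lim[of y] by (auto simp: indicator_def)
  qed
  show "norm (F y) \<le> B * exp (E * y)"
    if bound: "\<And>N y. y > 0 \<Longrightarrow> norm (\<Sum>n<N. c n * of_real y ^ (2 * n)) \<le> B * exp (E * y)" and "y > 0"
    using tendsto_norm[OF lim[OF \<open>y > 0\<close>]] bound[OF \<open>y > 0\<close>]
    by (intro LIMSEQ_le_const2[of "\<lambda>N. norm (P N y)"]) (auto simp: P_def)
qed

text \<open>Dominated convergence: the partial sums of \<open>F\<close> times \<open>W\<close> are
  bounded by a multiple of \<open>exp ((E + D) * y)\<close>, which is integrable against the weight.
  It is applied to I_0 with \<open>W = 1\<close>, and to a normalised product of Bessel functions
  with \<open>W\<close> equal to I_0.\<close>

lemma
  fixes s :: complex and p :: real and c :: "nat \<Rightarrow> complex" and F W :: "real \<Rightarrow> complex"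
  assumes s: "Re s > - 1" and p: "p > 0"
    and W: "set_borel_measurable lborel {0<..} W" "\<And>y. y > 0 \<Longrightarrow> norm (W y) \<le> C * exp (D * y)"
    and F: "\<And>y. y > 0 \<Longrightarrow> (\<lambda>n. c n * of_real y ^ (2 * n)) sums F y"
    and bound: "\<And>N y. y > 0 \<Longrightarrow> norm (\<Sum>n<N. c n * of_real y ^ (2 * n)) \<le> B * exp (E * y)"
  shows set_integrable_power_series_gaussian: "set_integrable lborel {0<..}
      (\<lambda>y. of_real y powr (2 * s + 1) * (F y * W y) * of_real (exp (- p * y\<^sup>2)))"
    and power_series_gaussian_integral_sums: "(\<lambda>n. c n * (LINT y:{0<..}|lborel.
        of_real y powr (2 * (s + of_nat n) + 1) * W y * of_real (exp (- p * y\<^sup>2)))) sums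
      (LINT y:{0<..}|lborel. of_real y powr (2 * s + 1) * (F y * W y) * of_real (exp (- p * y\<^sup>2)))"
proof -
  define P where "P N y = (\<Sum>n<N. c n * of_real y ^ (2 * n))" for N and y :: real
  have lim: "(\<lambda>N. P N y) \<longlonglongrightarrow> F y" if "y > 0" for y
    using F[OF that] unfolding P_def sums_def .
  have Fm: "set_borel_measurable lborel {0<..} F"
    using F by (rule set_borel_measurable_power_series)
  have Fb: "norm (F y) \<le> B * exp (E * y)" if "y > 0" for y
    using F bound that by (rule power_series_norm_bound)
  have prod_bound: "norm (G y * W y) \<le> (B * C) * exp ((E + D) * y)"
    if "y > 0" "norm (G y) \<le> B * exp (E * y)" for G :: "real \<Rightarrow> complex" and y
  proof -
    have "norm (G y * W y) \<le> (B * exp (E * y)) * (C * exp (D * y))"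
      unfolding norm_mult using that W(2)
      by (intro mult_mono) (auto intro: order.trans[OF norm_ge_zero])
    then show ?thesis by (simp add: distrib_left exp_add mult_ac)
  qed
  have prod_meas: "set_borel_measurable lborel {0<..} (\<lambda>y. G y * W y)"
    if "set_borel_measurable lborel {0<..} G" for G
  proof -
    have "(\<lambda>y. (indicator {0<..} y *\<^sub>R G y) * (indicator {0<..} y *\<^sub>R W y)) \<in> borel_measurable lborel"
      using that W(1) unfolding set_borel_measurable_def by (intro borel_measurable_times)
    then show ?thesis
      unfolding set_borel_measurable_def
      by (rule back_subst[where P = "\<lambda>f. f \<in> borel_measurable lborel"])
         (auto simp: fun_eq_iff indicator_def)
  qed
  let ?h = "\<lambda>G y. of_real y powr (2 * s + 1) * (G y * W y) * of_real (exp (- p * y\<^sup>2))"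
  let ?t = "\<lambda>n y. of_real y powr (2 * (s + of_nat n) + 1) * W y * of_real (exp (- p * y\<^sup>2))"
  show Fi: "set_integrable lborel {0<..} (?h F)"
    by (rule set_integrable_gaussian_weight[OF s p prod_meas[OF Fm]]) (rule prod_bound[of _ F, OF _ Fb])
  have ti: "set_integrable lborel {0<..} (?t n)" for n
    using s by (intro set_integrable_gaussian_weight[OF _ p W]) auto
  \<comment> \<open>Each power \<open>y ^ (2 * n)\<close> is absorbed into the weight by shifting
    \<open>s\<close> to \<open>s + n\<close>.\<close>
  have Pt: "indicator {0<..} y *\<^sub>R ?h (P N) y = (\<Sum>n<N. c n * (indicator {0<..} y *\<^sub>R ?t n y))"
    for N and y :: real
  proof (cases "y > 0")
    case True
    have "(of_real y :: complex) powr (2 * (s + of_nat n) + 1) =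
        of_real y powr (2 * s + 1) * of_real y ^ (2 * n)" for n
    proof -
      have "2 * (s + of_nat n) + 1 = (2 * s + 1) + of_nat (2 * n)" by simp
      then show ?thesis
        using True powr_nat'[of "of_real y :: complex" "2 * n"] by (simp only: powr_add) simp
    qed
    then show ?thesis
      using True by (simp add: P_def sum_distrib_left sum_distrib_right mult_ac)
  qed simp
  have "(\<lambda>N. LINT y|lborel. indicator {0<..} y *\<^sub>R ?h (P N) y)
      \<longlonglongrightarrow> (LINT y|lborel. indicator {0<..} y *\<^sub>R ?h F y)"
  proof (rule integral_dominated_convergence)
    let ?w = "\<lambda>y. norm (indicator {0<..} y *\<^sub>R
      (of_real y powr (2 * s + 1) * of_real (B * C * exp ((E + D) * y)) * of_real (exp (- p * y\<^sup>2)) :: complex))"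
    show "integrable lborel ?w"
      unfolding set_integrable_def[symmetric]
    proof (intro integrable_norm, unfold set_integrable_def[symmetric],
        rule set_integrable_gaussian_weight[OF s p])
      show "set_borel_measurable lborel {0<..} (\<lambda>y. complex_of_real (B * C * exp ((E + D) * y)))"
        unfolding set_borel_measurable_def
        by (auto intro!: borel_measurable_continuous_on_indicator continuous_intros)
      show "norm (complex_of_real (B * C * exp ((E + D) * y))) \<le> \<bar>B * C\<bar> * exp ((E + D) * y)" for y
        unfolding norm_of_real abs_mult by simp
    qed
    show "AE y in lborel. norm (indicator {0<..} y *\<^sub>R ?h (P N) y) \<le> ?w y" for N
    proof (rule AE_I2)
      fix y :: real
      show "norm (indicator {0<..} y *\<^sub>R ?h (P N) y) \<le> ?w y"
      proof (cases "y > 0")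
        case True
        then have "norm (P N y * W y) \<le> \<bar>(B * C) * exp ((E + D) * y)\<bar>"
          using prod_bound[of y "P N"] bound[of y N] by (simp add: P_def)
        then show ?thesis
          using True unfolding norm_mult norm_scaleR norm_of_real
          by (intro mult_left_mono mult_right_mono) auto
      qed simp
    qed
    show "AE y in lborel. (\<lambda>N. indicator {0<..} y *\<^sub>R ?h (P N) y) \<longlonglongrightarrow> indicator {0<..} y *\<^sub>R ?h F y"
    proof (rule AE_I2)
      fix y :: real
      show "(\<lambda>N. indicator {0<..} y *\<^sub>R ?h (P N) y) \<longlonglongrightarrow> indicator {0<..} y *\<^sub>R ?h F y"
        by (cases "y > 0") (auto intro!: tendsto_intros lim)
    qed
    show "(\<lambda>y. indicator {0<..} y *\<^sub>R ?h F y) \<in> borel_measurable lborel"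
      using Fi unfolding set_integrable_def by simp
    show "(\<lambda>y. indicator {0<..} y *\<^sub>R ?h (P N) y) \<in> borel_measurable lborel" for N
      unfolding Pt using ti unfolding set_integrable_def
      by (intro borel_measurable_sum borel_measurable_times borel_measurable_const) auto
  qed
  moreover have "(LINT y|lborel. indicator {0<..} y *\<^sub>R ?h (P N) y) =
      (\<Sum>n<N. c n * (LINT y:{0<..}|lborel. ?t n y))" for N
    unfolding Pt set_lebesgue_integral_def using ti[unfolded set_integrable_def]
    by (simp only: Bochner_Integration.integral_sum Bochner_Integration.integrable_mult_right
        Bochner_Integration.integral_mult_right simp_thms)
  ultimately show "(\<lambda>n. c n * (LINT y:{0<..}|lborel. ?t n y)) sums (LINT y:{0<..}|lborel. ?h F y)"
    unfolding sums_def set_lebesgue_integral_def[symmetric] by simp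
qed

section \<open>Gaussian integrals of Bessel functions\<close>

text \<open>The half-plane \<open>Re z > - 1\<close> contains a single pole of Gamma, namely
  0.\<close>

lemma not_nonpos_Int_of_Re_gt:
  assumes "Re z > - 1" and "z \<noteq> 0"
  shows "z \<notin> \<int>\<^sub>\<le>\<^sub>0"
proof
  assume "z \<in> \<int>\<^sub>\<le>\<^sub>0"
  then obtain n :: nat where n: "z = - of_nat n" by (elim nonpos_Ints_cases')
  with assms(1) have "n = 0" by simp
  with n assms(2) show False by simp
qed

text \<open>The argument is written \<open>2 * q * y\<close> so that its half is
  \<open>q * y\<close>; the powers of \<open>q\<close> then join the coefficients. The value needed
  is \<open>q = p * r\<close>.\<close>

lemma bessel_I_0_series:
  assumes "q > 0" and "y > 0"
  shows "(\<lambda>n. bessel_coeff 0 n * of_real q ^ (2 * n) * of_real y ^ (2 * n)) sums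
    bessel_I 0 (of_real (2 * q * y))"
proof -
  have "bessel_I 0 (of_real (2 * q * y)) = (\<Sum>n. bessel_coeff 0 n * of_real (q * y) ^ (2 * n))"
    using bessel_I_conv_coeff[of "2 * q * y" 0] assms by simp
  moreover have "summable (\<lambda>n. bessel_coeff 0 n * of_real (q * y) ^ (2 * n))"
    by (rule summable_norm_cancel[OF summable_bessel_coeff])
  ultimately have "(\<lambda>n. bessel_coeff 0 n * of_real (q * y) ^ (2 * n)) sums
      bessel_I 0 (of_real (2 * q * y))"
    by (simp add: sums_iff)
  then show ?thesis by (simp add: power_mult_distrib mult.assoc)
qed

lemma bessel_I_0_series_bound:
  assumes "q > 0"
  obtains B where
    "\<And>N y. y > 0 \<Longrightarrow> norm (\<Sum>n<N. bessel_coeff 0 n * of_real q ^ (2 * n) * of_real y ^ (2 * n))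
        \<le> B * exp (4 * q * y)"
proof -
  obtain B where B: "\<And>N z. (\<Sum>n<N. norm (bessel_coeff 0 n * z ^ (2 * n))) \<le> B * exp (4 * norm z)"
    using bessel_coeff_partial_sum_bound[of 0] by blast
  have "norm (\<Sum>n<N. bessel_coeff 0 n * of_real q ^ (2 * n) * of_real y ^ (2 * n))
        \<le> B * exp (4 * q * y)" if "y > 0" for N y
  proof -
    have "norm (\<Sum>n<N. bessel_coeff 0 n * of_real q ^ (2 * n) * of_real y ^ (2 * n))
        \<le> (\<Sum>n<N. norm (bessel_coeff 0 n * of_real (q * y) ^ (2 * n)))"
      by (rule order.trans[OF norm_sum]) (simp add: power_mult_distrib mult.assoc)
    also have "\<dots> \<le> B * exp (4 * q * y)"
      using B[where z = "of_real (q * y)"] assms that by (simp add: norm_mult mult.assoc)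
    finally show ?thesis .
  qed
  then show ?thesis by (rule that)
qed

lemma bessel_coeff_0: "bessel_coeff 0 n = 1 / (fact n)\<^sup>2"
  using Gamma_fact[of n, where 'a = complex]
  by (simp add: bessel_coeff_def rGamma_inverse_Gamma power2_eq_square divide_inverse add.commute)

text \<open>Integrating I_0 termwise gives Gaussian moments with \<open>s + n\<close> in place of
  \<open>s\<close>. Their Gamma values form the Pochhammer symbol of \<open>s + 1\<close>, one
  factor \<open>fact n\<close> is the Pochhammer symbol of 1, and
  \<open>(p * r) ^ (2 * n) / p ^ n\<close> is the power of \<open>p * r^2\<close>.\<close>

lemma gaussian_bessel_I_0_moment:
  fixes s :: complex and p r :: real
  assumes s: "Re s > - 1" and p: "p > 0" and r: "r > 0"
  shows "(LINT y:{0<..}|lborel. of_real y powr (2 * s + 1) * bessel_I 0 (of_real (2 * (p * r) * y)) *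
      of_real (exp (- p * y\<^sup>2))) =
    Gamma (s + 1) / (2 * of_real p powr (s + 1)) * hypergeom_1F1 (s + 1) 1 (of_real (p * r\<^sup>2))"
proof -
  have q: "p * r > 0" using p r by simp
  obtain B where B:
    "\<And>N y. y > 0 \<Longrightarrow> norm (\<Sum>n<N. bessel_coeff 0 n * of_real (p * r) ^ (2 * n) * of_real y ^ (2 * n))
        \<le> B * exp (4 * (p * r) * y)"
    using bessel_I_0_series_bound[OF q] by blast
  let ?A = "Gamma (s + 1) / (2 * of_real p powr (s + 1))"
  have np: "s + 1 \<notin> \<int>\<^sub>\<le>\<^sub>0" using s by (intro not_nonpos_Int_of_Re_gt) (auto simp: complex_eq_iff)
  have A: "?A \<noteq> 0" using np p by (simp add: Gamma_eq_zero_iff)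
  have one: "set_borel_measurable lborel {0<..} (\<lambda>_::real. 1 :: complex)"
    "norm (1 :: complex) \<le> 1 * exp (0 * y)" for y :: real
    unfolding set_borel_measurable_def
    by (auto intro!: borel_measurable_continuous_on_indicator)
  have "(\<lambda>n. bessel_coeff 0 n * of_real (p * r) ^ (2 * n) * (LINT y:{0<..}|lborel.
        of_real y powr (2 * (s + of_nat n) + 1) * 1 * of_real (exp (- p * y\<^sup>2)))) sums
      (LINT y:{0<..}|lborel. of_real y powr (2 * s + 1) *
        (bessel_I 0 (of_real (2 * (p * r) * y)) * 1) * of_real (exp (- p * y\<^sup>2)))"
    using s p one bessel_I_0_series[OF q] B by (rule power_series_gaussian_integral_sums)
  also have "(\<lambda>n. bessel_coeff 0 n * of_real (p * r) ^ (2 * n) * (LINT y:{0<..}|lborel.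
        of_real y powr (2 * (s + of_nat n) + 1) * 1 * of_real (exp (- p * y\<^sup>2)))) =
      (\<lambda>n. ?A * (pochhammer (s + 1) n / pochhammer 1 n * (of_real (p * r\<^sup>2) ^ n / fact n)))"
  proof
    fix n
    have "Re (s + of_nat n) > - 1" using s by simp
    then have "(LINT y:{0<..}|lborel.
        of_real y powr (2 * (s + of_nat n) + 1) * 1 * of_real (exp (- p * y\<^sup>2))) =
        Gamma (s + of_nat n + 1) / (2 * of_real p powr (s + of_nat n + 1))"
      using gaussian_moment[of "s + of_nat n" p] p by simp
    moreover have "of_real p powr (s + of_nat n + 1) = of_real p powr (s + 1) * of_real p ^ n"
    proof -
      have "s + of_nat n + 1 = (s + 1) + of_nat n" by simp
      then show ?thesis using p powr_nat'[of "of_real p :: complex" n] by (simp only: powr_add) simp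
    qed
    moreover have "Gamma (s + of_nat n + 1) = Gamma (s + 1) * pochhammer (s + 1) n"
      using pochhammer_Gamma[OF np, of n] np by (simp add: Gamma_eq_zero_iff add_ac)
    moreover have "complex_of_real (p * r) ^ (2 * n) = of_real (p * r\<^sup>2) ^ n * of_real p ^ n"
    proof -
      have "(complex_of_real (p * r))\<^sup>2 = of_real (p * r\<^sup>2) * of_real p"
        by (simp add: power2_eq_square)
      then show ?thesis by (simp only: power_mult power_mult_distrib)
    qed
    ultimately show "bessel_coeff 0 n * of_real (p * r) ^ (2 * n) * (LINT y:{0<..}|lborel.
        of_real y powr (2 * (s + of_nat n) + 1) * 1 * of_real (exp (- p * y\<^sup>2))) =
      ?A * (pochhammer (s + 1) n / pochhammer 1 n * (of_real (p * r\<^sup>2) ^ n / fact n))"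
      using p by (simp add: bessel_coeff_0 pochhammer_fact[symmetric] power2_eq_square del: of_real_mult)
        (simp add: mult_ac del: of_real_mult)
  qed
  finally have sums: "(\<lambda>n. ?A * (pochhammer (s + 1) n / pochhammer 1 n * (of_real (p * r\<^sup>2) ^ n / fact n))) sums
    (LINT y:{0<..}|lborel. of_real y powr (2 * s + 1) *
        (bessel_I 0 (of_real (2 * (p * r) * y)) * 1) * of_real (exp (- p * y\<^sup>2)))" .
  \<comment> \<open>Convergence of the 1F1 series comes from the termwise integration itself, by
    dividing out the nonzero constant \<open>?A\<close>.\<close>
  from sums_summable[OF sums] have "summable (\<lambda>n. pochhammer (s + 1) n / pochhammer 1 n * (of_real (p * r\<^sup>2) ^ n / fact n))"
    using A by (subst (asm) summable_cmult_iff) auto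
  from suminf_mult[OF this, of ?A] sums_unique[OF sums] show ?thesis
    by (simp add: hypergeom_1F1_def)
qed

text \<open>Stripped of its leading power, the product is the even series \<open>F\<close>; that
  power and the factor \<open>y\<close> make up the weight \<open>y powr (2 * s + 1)\<close>. The
  two instances needed are \<open>s = v\<close> for the square of I_v and \<open>s = 0\<close> for
  the mixed product.\<close>

lemma
  fixes \<mu> \<nu> :: complex and a p r :: real
  assumes \<mu>: "\<mu> \<notin> \<int>" and \<nu>: "\<nu> \<notin> \<int>" and s: "\<mu> + \<nu> = 2 * s" "Re s > - 1"
    and a: "a > 0" and p: "p > 0" and r: "r > 0"
  shows set_integrable_bessel_product:
      "set_integrable lborel {0<..} (\<lambda>y. of_real y * (bessel_I \<mu> (of_real (a * y)) * bessel_I \<nu> (of_real (a * y))) *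
        bessel_I 0 (of_real (2 * (p * r) * y)) * of_real (exp (- p * y\<^sup>2)))"
    and bessel_product_integral_sums:
      "(\<lambda>n. of_real (a / 2) powr (2 * s) * bessel_prod_coeff \<mu> \<nu> n * of_real (a / 2) ^ (2 * n) *
        (Gamma (s + of_nat n + 1) / (2 * of_real p powr (s + of_nat n + 1)) *
          hypergeom_1F1 (s + of_nat n + 1) 1 (of_real (p * r\<^sup>2)))) sums
      (LINT y:{0<..}|lborel. of_real y * (bessel_I \<mu> (of_real (a * y)) * bessel_I \<nu> (of_real (a * y))) *
        bessel_I 0 (of_real (2 * (p * r) * y)) * of_real (exp (- p * y\<^sup>2)))"
proof -
  have q: "p * r > 0" using p r by simp
  obtain B where B:
    "\<And>N y. y > 0 \<Longrightarrow> norm (\<Sum>n<N. bessel_coeff 0 n * of_real (p * r) ^ (2 * n) * of_real y ^ (2 * n))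
        \<le> B * exp (4 * (p * r) * y)"
    using bessel_I_0_series_bound[OF q] by blast
  let ?W = "\<lambda>y. bessel_I 0 (of_real (2 * (p * r) * y))"
  have W: "set_borel_measurable lborel {0<..} ?W"
    using bessel_I_0_series[OF q] by (rule set_borel_measurable_power_series)
  have Wb: "norm (?W y) \<le> B * exp (4 * (p * r) * y)" if "y > 0" for y
    using bessel_I_0_series[OF q] B that by (rule power_series_norm_bound)
  let ?II = "\<lambda>y. bessel_I \<mu> (of_real (a * y)) * bessel_I \<nu> (of_real (a * y))"
  define F where "F y = of_real (a * y / 2) powr (- (2 * s)) * ?II y" for y
  define c where "c n = bessel_prod_coeff \<mu> \<nu> n * of_real (a / 2) ^ (2 * n)" for n
  have c: "c n * of_real y ^ (2 * n) = bessel_prod_coeff \<mu> \<nu> n * of_real (a * y / 2) ^ (2 * n)" for n y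
    by (simp add: c_def power_mult_distrib power_divide)
  have F: "(\<lambda>n. c n * of_real y ^ (2 * n)) sums F y" if "y > 0" for y
    using bessel_prod_coeff_sums[OF \<mu> \<nu>, of "a * y"] a that unfolding c F_def s(1) by simp
  obtain C where C: "\<And>N z. norm (\<Sum>n<N. bessel_prod_coeff \<mu> \<nu> n * z ^ (2 * n)) \<le> C * exp (8 * norm z)"
    using bessel_prod_coeff_bound[OF \<mu> \<nu>] by blast
  \<comment> \<open>The rate 8 meets the half argument \<open>a * y / 2\<close>, hence
    \<open>4 * a\<close>.\<close>
  have Fb: "norm (\<Sum>n<N. c n * of_real y ^ (2 * n)) \<le> C * exp (4 * a * y)" if "y > 0" for N y
    using C[where z = "of_real (a * y / 2)"] a that unfolding c by (simp add: norm_mult norm_divide mult.assoc)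
  note facts = s(2) p W Wb F Fb
  let ?G = "\<lambda>y. of_real y powr (2 * s + 1) * (F y * ?W y) * of_real (exp (- p * y\<^sup>2))"
  let ?H = "\<lambda>y. of_real y * ?II y * ?W y * of_real (exp (- p * y\<^sup>2))"
  let ?k = "of_real (a / 2) powr (2 * s) :: complex"
  have eq: "?k * ?G y = ?H y" if "y > 0" for y
  proof -
    have "complex_of_real (a * y / 2) powr (2 * s) = ?k * of_real y powr (2 * s)"
      using powr_times_real[of "of_real (a / 2)" "of_real y" "2 * s"] a that by simp
    moreover have "complex_of_real (a * y / 2) powr (2 * s) * of_real (a * y / 2) powr (- (2 * s)) = 1"
      using a that by (subst powr_add[symmetric]) simp
    moreover have "?k * ?G y = (?k * of_real y powr (2 * s) * of_real (a * y / 2) powr (- (2 * s))) * ?H y"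
      using that by (simp add: F_def powr_add mult_ac)
    ultimately show ?thesis by simp
  qed
  have "set_integrable lborel {0<..} (\<lambda>y. ?k * ?G y)"
    by (rule set_integrable_mult_right, rule set_integrable_power_series_gaussian)
       (use facts in auto)
  then show "set_integrable lborel {0<..} ?H"
    by (subst (asm) set_integrable_cong[OF refl refl eq]) auto
  have "(\<lambda>n. c n * (LINT y:{0<..}|lborel.
      of_real y powr (2 * (s + of_nat n) + 1) * ?W y * of_real (exp (- p * y\<^sup>2)))) sums
      (LINT y:{0<..}|lborel. ?G y)"
    using facts by (rule power_series_gaussian_integral_sums)
  moreover have "(LINT y:{0<..}|lborel.
      of_real y powr (2 * (s + of_nat n) + 1) * ?W y * of_real (exp (- p * y\<^sup>2))) =
      Gamma (s + of_nat n + 1) / (2 * of_real p powr (s + of_nat n + 1)) *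
          hypergeom_1F1 (s + of_nat n + 1) 1 (of_real (p * r\<^sup>2))" for n
    using s(2) p r by (intro gaussian_bessel_I_0_moment) auto
  ultimately have "(\<lambda>n. ?k * (c n * (Gamma (s + of_nat n + 1) / (2 * of_real p powr (s + of_nat n + 1)) *
          hypergeom_1F1 (s + of_nat n + 1) 1 (of_real (p * r\<^sup>2))))) sums
      (?k * (LINT y:{0<..}|lborel. ?G y))"
    by (intro sums_mult) (simp only:)
  moreover have "?k * (LINT y:{0<..}|lborel. ?G y) = (LINT y:{0<..}|lborel. ?H y)"
    unfolding set_integral_mult_right[symmetric] using eq
    by (intro set_lebesgue_integral_cong) auto
  ultimately show "(\<lambda>n. ?k * bessel_prod_coeff \<mu> \<nu> n * of_real (a / 2) ^ (2 * n) *
        (Gamma (s + of_nat n + 1) / (2 * of_real p powr (s + of_nat n + 1)) *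
          hypergeom_1F1 (s + of_nat n + 1) 1 (of_real (p * r\<^sup>2)))) sums
      (LINT y:{0<..}|lborel. ?H y)"
    by (simp only: c_def mult.assoc)
qed

section \<open>Gamma function identities\<close>

text \<open>Legendre's duplication formula at \<open>s + n + 1 / 2\<close> splits the numerator
  \<open>Gamma (2 * (s + n) + 1)\<close> of the binomial; its power of 2 is
  \<open>4 powr s * 4 ^ n\<close>.\<close>

lemma gbinomial_duplication:
  fixes s :: complex
  assumes "2 * (s + of_nat n) + 1 \<notin> \<int>\<^sub>\<le>\<^sub>0" "s + of_nat n + 1 / 2 \<notin> \<int>\<^sub>\<le>\<^sub>0" "s + of_nat n + 1 \<notin> \<int>\<^sub>\<le>\<^sub>0"
  shows "of_real (sqrt pi) * ((2 * s + 2 * of_nat n) gchoose n) =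
    4 powr s * 4 ^ n * Gamma (1 / 2 + of_nat n + s) * Gamma (s + of_nat n + 1) /
      (fact n * Gamma (2 * s + 1 + of_nat n))"
proof -
  have "((2 * s + 2 * of_nat n) gchoose n) =
      Gamma (2 * (s + of_nat n) + 1) / (fact n * Gamma (2 * s + 1 + of_nat n))"
    using gbinomial_Gamma[OF assms(1), of n] by (simp add: algebra_simps)
  moreover have "Gamma (s + of_nat n + 1 / 2) * Gamma (s + of_nat n + 1) =
      exp (- (2 * (s + of_nat n)) * of_real (ln 2)) * of_real (sqrt pi) * Gamma (2 * (s + of_nat n) + 1)"
    using Gamma_legendre_duplication[of "s + of_nat n + 1 / 2"] assms(2,3)
    by (simp add: algebra_simps)
  moreover have "4 powr s * 4 ^ n * exp (- (2 * (s + of_nat n)) * of_real (ln 2)) = (1 :: complex)"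
  proof -
    have ln4: "Ln (4 :: complex) = 2 * of_real (ln 2)"
      using Ln_of_real[of 4] ln_realpow[of 2 2] by simp
    have "(4 :: complex) powr s * 4 ^ n = 4 powr (s + of_nat n)"
      using powr_nat'[of "4 :: complex" n] by (simp add: powr_add)
    also have "\<dots> = exp (2 * (s + of_nat n) * of_real (ln 2))"
      by (simp add: powr_def ln4 algebra_simps)
    finally show ?thesis by (simp only: exp_add[symmetric]) (simp add: algebra_simps)
  qed
  then have "4 powr s * 4 ^ n *
      (exp (- (2 * (s + of_nat n)) * of_real (ln 2)) * of_real (sqrt pi) * Gamma (2 * (s + of_nat n) + 1)) =
      of_real (sqrt pi) * Gamma (2 * (s + of_nat n) + 1)"
    by (simp only: mult.assoc[symmetric] mult_1_left)
  ultimately show ?thesis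
    by (simp add: add_ac mult.assoc)
qed

lemma sin_pi_diff_nat:
  fixes z :: complex
  shows "sin (of_real pi * (z - of_nat n)) = (- 1) ^ n * sin (of_real pi * z)"
proof -
  have "of_real pi * (of_nat n :: complex) = of_real (pi * real n)" by simp
  then show ?thesis
    by (simp only: right_diff_distrib sin_diff sin_of_real cos_of_real)
       (simp add: mult.commute[of pi])
qed

text \<open>Euler's reflection formula at \<open>v - n\<close>. The sign \<open>(- 1) ^ n\<close>
  later turns the powers of \<open>a^2 / p\<close> into those of \<open>- (a^2 / p)\<close>.\<close>

lemma Gamma_reflection_shift:
  fixes v :: complex
  assumes "v \<notin> \<int>"
  shows "of_real pi / sin (of_real pi * v) = (- 1) ^ n * (Gamma (v - of_nat n) * Gamma (- v + of_nat n + 1))"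
proof -
  have "1 - (v - of_nat n) = - v + of_nat n + 1" by simp
  then have "Gamma (v - of_nat n) * Gamma (- v + of_nat n + 1) = of_real pi / ((- 1) ^ n * sin (of_real pi * v))"
    using Gamma_reflection_complex[of "v - of_nat n"] by (simp only: sin_pi_diff_nat)
  moreover have "((- 1) ^ n * (- 1) ^ n :: complex) = 1"
    by (simp flip: power_mult_distrib)
  ultimately show ?thesis by (simp add: field_simps)
qed

text \<open>The powers of 4 from the duplication formula undo the halves in \<open>a / 2\<close>,
  and the powers of \<open>p\<close> combine with \<open>a^2\<close> into \<open>a^2 / p\<close>.
  The outer \<open>2 * p\<close> cancels what is left of the Gaussian moment. The value of 1F1
  enters only as the parameter \<open>h\<close>.\<close>

lemma bessel_product_term_eq:
  fixes \<mu> \<nu> s :: complex and a p :: real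
  assumes s: "\<mu> + \<nu> = 2 * s" "Re s > - 1" "s \<noteq> - 1 / 2"
    and a: "a > 0" and p: "p > 0"
  shows "2 * of_real p * (of_real (a / 2) powr (2 * s) * bessel_prod_coeff \<mu> \<nu> n * of_real (a / 2) ^ (2 * n) *
      (Gamma (s + of_nat n + 1) / (2 * of_real p powr (s + of_nat n + 1)) * h)) =
    of_real (a\<^sup>2 / p) powr s / of_real (sqrt pi) *
      (h * (Gamma (1 / 2 + of_nat n + s) * Gamma (s + of_nat n + 1) ^ 2 /
        (fact n * Gamma (2 * s + 1 + of_nat n) * (Gamma (\<mu> + of_nat n + 1) * Gamma (\<nu> + of_nat n + 1)))) *
        of_real (a\<^sup>2 / p) ^ n)"
proof -
  \<comment> \<open>Only \<open>n = 0\<close> with \<open>s = - 1 / 2\<close> could give zero; for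
    larger \<open>n\<close> the real part is positive.\<close>
  have nz: "s + of_nat n + 1 / 2 \<noteq> 0"
  proof (cases n)
    case 0
    then show ?thesis using s(3) by (simp add: eq_neg_iff_add_eq_0)
  next
    case (Suc m)
    then have "Re (s + of_nat n + 1 / 2) > 0" using s(2) by simp
    then show ?thesis by (metis less_irrefl zero_complex.sel(1))
  qed
  then have nz': "2 * (s + of_nat n) + 1 \<noteq> 0" by (simp add: field_simps)
  have nz'': "s + of_nat n + 1 \<noteq> 0" using s(2) by (auto simp: complex_eq_iff)
  have np: "2 * (s + of_nat n) + 1 \<notin> \<int>\<^sub>\<le>\<^sub>0" "s + of_nat n + 1 / 2 \<notin> \<int>\<^sub>\<le>\<^sub>0" "s + of_nat n + 1 \<notin> \<int>\<^sub>\<le>\<^sub>0"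
    using s(2) by (intro not_nonpos_Int_of_Re_gt nz nz' nz''; simp)+
  define P where "P = complex_of_real p powr s"
  define X where "X = complex_of_real (a / 2) powr (2 * s)"
  define Q where "Q = Gamma (1 / 2 + of_nat n + s) * Gamma (s + of_nat n + 1) / (fact n * Gamma (2 * s + 1 + of_nat n))"
  define R where "R = Gamma (\<mu> + of_nat n + 1) * Gamma (\<nu> + of_nat n + 1)"
  define G where "G = Gamma (s + of_nat n + 1)"
  have P: "of_real p powr (s + of_nat n + 1) = P * of_real p ^ n * of_real p"
    using p powr_nat'[of "of_real p :: complex" n] by (simp add: powr_add P_def)
  have "P \<noteq> 0" using p by (simp add: P_def)
  have XP: "X * 4 powr s = of_real (a\<^sup>2 / p) powr s * P"
  proof -
    have "of_real (a\<^sup>2 / p) powr s * P = of_real (a\<^sup>2) powr s"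
      using powr_times_real[of "of_real (a\<^sup>2 / p)" "of_real p" s] a p by (simp add: P_def)
    also have "\<dots> = of_real ((a / 2)\<^sup>2) powr s * 4 powr s"
      using powr_times_real[of "of_real ((a / 2)\<^sup>2)" 4 s] a by (simp add: power_divide)
    also have "of_real ((a / 2)\<^sup>2) powr s = X"
      using powr_times_real[of "of_real (a / 2)" "of_real (a / 2)" s] a
      unfolding X_def mult_2 powr_add by (simp add: power2_eq_square)
    finally show ?thesis by simp
  qed
  have a_pow: "of_real (a / 2) ^ (2 * n) * 4 ^ n / of_real p ^ n = (of_real (a\<^sup>2 / p) ^ n :: complex)"
  proof -
    have "(of_real (a / 2))\<^sup>2 * 4 / of_real p = (of_real (a\<^sup>2 / p) :: complex)"
      by (simp add: power_divide)
    then show ?thesis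
      by (simp only: power_mult power_mult_distrib[symmetric] power_divide[symmetric])
  qed
  have coeff: "bessel_prod_coeff \<mu> \<nu> n = 4 powr s * 4 ^ n * Q / (of_real (sqrt pi) * R)"
  proof -
    have "of_real (sqrt pi) * ((2 * s + 2 * of_nat n) gchoose n) = 4 powr s * 4 ^ n * Q"
      using gbinomial_duplication[OF np] by (simp add: Q_def mult.assoc)
    then have "((2 * s + 2 * of_nat n) gchoose n) = 4 powr s * 4 ^ n * Q / of_real (sqrt pi)"
      by (simp add: nonzero_eq_divide_eq mult.commute)
    then show ?thesis
      unfolding bessel_prod_coeff_def s(1) R_def by simp
  qed
  have "2 * of_real p * (X * bessel_prod_coeff \<mu> \<nu> n * of_real (a / 2) ^ (2 * n) *
      (G / (2 * of_real p powr (s + of_nat n + 1)) * h)) =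
      (X * 4 powr s) / P * (Q / (of_real (sqrt pi) * R)) * (of_real (a / 2) ^ (2 * n) * 4 ^ n / of_real p ^ n) * G * h"
    using p \<open>P \<noteq> 0\<close> unfolding P coeff by (simp add: mult_ac)
  also have "\<dots> = of_real (a\<^sup>2 / p) powr s / of_real (sqrt pi) * (h * (Q * G / R) * of_real (a\<^sup>2 / p) ^ n)"
    using \<open>P \<noteq> 0\<close> unfolding XP a_pow by (simp add: mult_ac)
  finally show ?thesis
    unfolding Q_def R_def G_def X_def by (simp add: power2_eq_square mult_ac)
qed

section \<open>The solution of the diffusion equation\<close>

text \<open>The condition \<open>Re v > - 1\<close> makes \<open>y powr (2 * v + 1)\<close>, the
  behaviour of \<open>y\<close> times the square of I_v near 0, integrable there. At
  \<open>v = - 1 / 2\<close> the quotient \<open>Gamma (1 / 2 + v) / Gamma (2 * v + 1)\<close> in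
  the term \<open>n = 0\<close> would be \<open>0 / 0\<close>, hence 0, instead of its limit 2. In
  the prefactor, \<open>1 / 2\<close> stems from K_v and \<open>1 / sqrt pi\<close> from
  duplication.\<close>

theorem theorem1p3:
  fixes \<kappa> a r t :: real and v :: complex
  assumes "\<kappa> > 0" and "a > 0" and "r > 0" and "t > 0"
    and "v \<notin> \<int>"
    and "Re v > - 1" and "v \<noteq> - 1 / 2"
  shows "set_integrable lborel {0<..} (axisym_diffusion_integrand \<kappa> (IK_initial v a) r t) \<and>
    summable (IK_term1 v \<kappa> a r t) \<and>
    summable (IK_term2 v \<kappa> a r t) \<and>
    axisym_diffusion_solution \<kappa> (IK_initial v a) r t =
           of_real (exp (- r\<^sup>2 / (4 * \<kappa> * t))) *
             (of_real (4 * \<kappa> * t * a\<^sup>2) powr v / of_real (2 * sqrt pi)) *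
             (\<Sum>n. IK_term1 v \<kappa> a r t n)
           + of_real (exp (- r\<^sup>2 / (4 * \<kappa> * t)) / (2 * sqrt pi)) *
             (\<Sum>n. IK_term2 v \<kappa> a r t n)"
proof -
  define p where "p = 1 / (4 * \<kappa> * t)"
  have p: "p > 0" using assms by (simp add: p_def)
  have p_simps: "r\<^sup>2 / (4 * \<kappa> * t) = p * r\<^sup>2"
    "4 * \<kappa> * t * a\<^sup>2 = a\<^sup>2 / p" "- 4 * a\<^sup>2 * \<kappa> * t = - (a\<^sup>2 / p)" "1 / (2 * \<kappa> * t) = 2 * p"
    "y * r / (2 * \<kappa> * t) = 2 * (p * r) * y" "- y\<^sup>2 / (4 * \<kappa> * t) = - p * y\<^sup>2" for y
    using assms by (simp_all add: p_def field_simps)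
  have v': "- v \<notin> \<int>" using assms(5) by simp
  let ?K = "of_real pi / (2 * sin (of_real pi * v)) :: complex"
  let ?f = "\<lambda>\<nu> y. of_real y * (bessel_I v (of_real (a * y)) * bessel_I \<nu> (of_real (a * y))) *
      bessel_I 0 (of_real (2 * (p * r) * y)) * of_real (exp (- p * y\<^sup>2))"
  let ?int = "\<lambda>\<nu>. LINT y:{0<..}|lborel. ?f \<nu> y"
  let ?H = "\<lambda>s. hypergeom_1F1 s 1 (of_real (p * r\<^sup>2))"
  have integrable: "set_integrable lborel {0<..} (?f v)" "set_integrable lborel {0<..} (?f (- v))"
    using set_integrable_bessel_product[of v v v a p r] set_integrable_bessel_product[of v "- v" 0 a p r]
      assms p v' by auto
  have integrand: "axisym_diffusion_integrand \<kappa> (IK_initial v a) r t = (\<lambda>y. ?K * (?f (- v) y - ?f v y))"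
    unfolding axisym_diffusion_integrand_def IK_initial_def bessel_K_def p_simps
    by (simp add: fun_eq_iff algebra_simps diff_divide_distrib)
  have solution: "axisym_diffusion_solution \<kappa> (IK_initial v a) r t =
      of_real (exp (- p * r\<^sup>2)) * (2 * of_real p * ?K * (?int (- v) - ?int v))"
    unfolding axisym_diffusion_solution_def integrand p_simps set_integral_mult_right
    using integrable by (simp add: set_integral_diff mult_ac)

  \<comment> \<open>The square of I_v and the first series\<close>
  have "(\<lambda>n. - ?K * (2 * of_real p * (of_real (a / 2) powr (2 * v) * bessel_prod_coeff v v n * of_real (a / 2) ^ (2 * n) *
        (Gamma (v + of_nat n + 1) / (2 * of_real p powr (v + of_nat n + 1)) * ?H (v + of_nat n + 1))))) sums
      (- ?K * (2 * of_real p * ?int v))"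
    using assms p by (intro sums_mult bessel_product_integral_sums) auto
  also have "(\<lambda>n. - ?K * (2 * of_real p * (of_real (a / 2) powr (2 * v) * bessel_prod_coeff v v n * of_real (a / 2) ^ (2 * n) *
        (Gamma (v + of_nat n + 1) / (2 * of_real p powr (v + of_nat n + 1)) * ?H (v + of_nat n + 1))))) =
      (\<lambda>n. of_real (a\<^sup>2 / p) powr v / of_real (2 * sqrt pi) * IK_term1 v \<kappa> a r t n)"
  proof
    fix n
    have np: "v + of_nat n + 1 \<notin> \<int>\<^sub>\<le>\<^sub>0"
      using assms(5) by (auto dest!: nonpos_Ints_Int)
    \<comment> \<open>Reflection is used at \<open>- v\<close>: the sine is odd, which accounts for
      the minus sign of the square of I_v in the initial data.\<close>
    have "of_real pi / sin (of_real pi * - v) = (- 1) ^ n * (Gamma (- v - of_nat n) * Gamma (v + of_nat n + 1))"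
      using Gamma_reflection_shift[OF v', of n] by simp
    then have K: "- ?K = (- 1) ^ n * (Gamma (- v - of_nat n) * Gamma (v + of_nat n + 1)) / 2"
      by (simp add: field_simps)
    have minus_pow: "of_real (- (a\<^sup>2 / p)) ^ n = ((- 1) ^ n * of_real (a\<^sup>2 / p) ^ n :: complex)"
      by (simp flip: power_mult_distrib)
    have G: "Gamma (v + of_nat n + 1) \<noteq> 0" using np by (simp add: Gamma_eq_zero_iff)
    have arg: "1 + v + of_nat n = v + of_nat n + 1" by simp
    have eq: "2 * of_real p * (of_real (a / 2) powr (2 * v) * bessel_prod_coeff v v n * of_real (a / 2) ^ (2 * n) *
        (Gamma (v + of_nat n + 1) / (2 * of_real p powr (v + of_nat n + 1)) * ?H (v + of_nat n + 1))) =
      of_real (a\<^sup>2 / p) powr v / of_real (sqrt pi) *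
      (?H (v + of_nat n + 1) * (Gamma (1 / 2 + of_nat n + v) * Gamma (v + of_nat n + 1) ^ 2 /
        (fact n * Gamma (2 * v + 1 + of_nat n) * (Gamma (v + of_nat n + 1) * Gamma (v + of_nat n + 1)))) *
        of_real (a\<^sup>2 / p) ^ n)"
      using assms p by (intro bessel_product_term_eq) auto
    show "- ?K * (2 * of_real p * (of_real (a / 2) powr (2 * v) * bessel_prod_coeff v v n * of_real (a / 2) ^ (2 * n) *
        (Gamma (v + of_nat n + 1) / (2 * of_real p powr (v + of_nat n + 1)) * ?H (v + of_nat n + 1)))) =
      of_real (a\<^sup>2 / p) powr v / of_real (2 * sqrt pi) * IK_term1 v \<kappa> a r t n"
      unfolding eq unfolding K IK_term1_def p_simps minus_pow arg using G
      by (simp add: power2_eq_square mult_ac del: of_real_divide of_real_power of_real_mult)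
         (simp add: mult_ac)
  qed
  finally have sums1: "(\<lambda>n. of_real (a\<^sup>2 / p) powr v / of_real (2 * sqrt pi) * IK_term1 v \<kappa> a r t n) sums
      (- ?K * (2 * of_real p * ?int v))" .

  \<comment> \<open>The mixed product of I_v and I_{-v} and the second series\<close>
  have "(\<lambda>n. ?K * (2 * of_real p * (of_real (a / 2) powr (2 * 0) * bessel_prod_coeff v (- v) n * of_real (a / 2) ^ (2 * n) *
        (Gamma (0 + of_nat n + 1) / (2 * of_real p powr (0 + of_nat n + 1)) * ?H (0 + of_nat n + 1))))) sums
      (?K * (2 * of_real p * ?int (- v)))"
    using assms p v' by (intro sums_mult bessel_product_integral_sums) auto
  also have "(\<lambda>n. ?K * (2 * of_real p * (of_real (a / 2) powr (2 * 0) * bessel_prod_coeff v (- v) n * of_real (a / 2) ^ (2 * n) *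
        (Gamma (0 + of_nat n + 1) / (2 * of_real p powr (0 + of_nat n + 1)) * ?H (0 + of_nat n + 1))))) =
      (\<lambda>n. 1 / of_real (2 * sqrt pi) * IK_term2 v \<kappa> a r t n)"
  proof
    fix n
    have np: "- v + of_nat n + 1 \<notin> \<int>\<^sub>\<le>\<^sub>0"
      using v' by (auto dest!: nonpos_Ints_Int)
    have K: "?K = (- 1) ^ n * (Gamma (v - of_nat n) * Gamma (- v + of_nat n + 1)) / 2"
      using Gamma_reflection_shift[OF assms(5), of n] by (simp add: field_simps)
    have minus_pow: "of_real (- (a\<^sup>2 / p)) ^ n = ((- 1) ^ n * of_real (a\<^sup>2 / p) ^ n :: complex)"
      by (simp flip: power_mult_distrib)
    have G: "Gamma (- v + of_nat n + 1) \<noteq> 0" using np by (simp add: Gamma_eq_zero_iff)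
    have arg: "1 + of_nat n = (0 + of_nat n + 1 :: complex)" "v + 1 + of_nat n = v + of_nat n + 1" by simp_all
    \<comment> \<open>For \<open>s = 0\<close> all factorials cancel. The reflection factor then
      removes \<open>Gamma (- v + n + 1)\<close> from the denominator and leaves
      \<open>Gamma (v - n)\<close> on top.\<close>
    have fact: "Gamma (0 + of_nat n + 1 :: complex) = fact n" "Gamma (2 * 0 + 1 + of_nat n :: complex) = fact n"
      using Gamma_fact[of n, where 'a = complex] by (simp_all add: add.commute)
    have powr0: "of_real (a\<^sup>2 / p) powr 0 = (1 :: complex)" using assms p by simp
    have eq: "2 * of_real p * (of_real (a / 2) powr (2 * 0) * bessel_prod_coeff v (- v) n * of_real (a / 2) ^ (2 * n) *
        (Gamma (0 + of_nat n + 1) / (2 * of_real p powr (0 + of_nat n + 1)) * ?H (0 + of_nat n + 1))) =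
      of_real (a\<^sup>2 / p) powr 0 / of_real (sqrt pi) *
      (?H (0 + of_nat n + 1) * (Gamma (1 / 2 + of_nat n + 0) * Gamma (0 + of_nat n + 1) ^ 2 /
        (fact n * Gamma (2 * 0 + 1 + of_nat n) * (Gamma (v + of_nat n + 1) * Gamma (- v + of_nat n + 1)))) *
        of_real (a\<^sup>2 / p) ^ n)"
      using assms p by (intro bessel_product_term_eq) auto
    show "?K * (2 * of_real p * (of_real (a / 2) powr (2 * 0) * bessel_prod_coeff v (- v) n * of_real (a / 2) ^ (2 * n) *
        (Gamma (0 + of_nat n + 1) / (2 * of_real p powr (0 + of_nat n + 1)) * ?H (0 + of_nat n + 1)))) =
      1 / of_real (2 * sqrt pi) * IK_term2 v \<kappa> a r t n"
      unfolding eq unfolding K IK_term2_def p_simps minus_pow arg fact powr0 using G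
      by (simp add: power2_eq_square mult_ac del: of_real_divide of_real_power of_real_mult)
         (simp add: mult_ac)
  qed
  finally have sums2: "(\<lambda>n. 1 / of_real (2 * sqrt pi) * IK_term2 v \<kappa> a r t n) sums
      (?K * (2 * of_real p * ?int (- v)))" .

  \<comment> \<open>Convergence is known for constant multiples of the two series; nonzero constants
    transfer it to the series themselves.\<close>
  have nz: "of_real (a\<^sup>2 / p) powr v / of_real (2 * sqrt pi) \<noteq> (0 :: complex)"
    "1 / of_real (2 * sqrt pi) \<noteq> (0 :: complex)"
    using assms p by simp_all
  have summable1: "summable (IK_term1 v \<kappa> a r t)"
    using sums_summable[OF sums1] unfolding summable_cmult_iff using nz by simp
  have summable2: "summable (IK_term2 v \<kappa> a r t)"
    using sums_summable[OF sums2] unfolding summable_cmult_iff using nz by simp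
  have "set_integrable lborel {0<..} (axisym_diffusion_integrand \<kappa> (IK_initial v a) r t)"
    unfolding integrand using integrable by (intro set_integrable_mult_right set_integral_diff(1))
  moreover have "axisym_diffusion_solution \<kappa> (IK_initial v a) r t =
      of_real (exp (- p * r\<^sup>2)) * (of_real (a\<^sup>2 / p) powr v / of_real (2 * sqrt pi)) * (\<Sum>n. IK_term1 v \<kappa> a r t n)
      + of_real (exp (- p * r\<^sup>2) / (2 * sqrt pi)) * (\<Sum>n. IK_term2 v \<kappa> a r t n)"
  proof -
    have "- ?K * (2 * of_real p * ?int v) =
        of_real (a\<^sup>2 / p) powr v / of_real (2 * sqrt pi) * (\<Sum>n. IK_term1 v \<kappa> a r t n)"
      using sums_unique[OF sums1] suminf_mult[OF summable1] by metis
    moreover have "?K * (2 * of_real p * ?int (- v)) =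
        1 / of_real (2 * sqrt pi) * (\<Sum>n. IK_term2 v \<kappa> a r t n)"
      using sums_unique[OF sums2] suminf_mult[OF summable2] by metis
    moreover have "2 * of_real p * ?K * (?int (- v) - ?int v) =
        - ?K * (2 * of_real p * ?int v) + ?K * (2 * of_real p * ?int (- v))"
      by (simp only: right_diff_distrib mult_minus_left mult_ac) simp
    ultimately show ?thesis
      unfolding solution by (simp only: distrib_left mult.assoc of_real_divide) simp
  qed
  ultimately show ?thesis
    using summable1 summable2 unfolding p_simps by blast
qed

end
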